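(* Let $G$ be an abelian group and let $\varphi\in\mathrm{End}(G)$ be surjective. The following conditions are equivalent: (i) $ns(\varphi)=0$; (ii) $ns(\varphi)<\infty$; (iii) $G=Q\mathrm{Per}(\varphi)$.
   Context: $\mathbb N=\{0,1,2,\dots\}$ and $\mathbb N_+=\mathbb N\setminus\{0\}$. For an endomorphism $\varphi$ of an abelian group $G$: $Q\mathrm{Per}(\varphi)$ is the set of $x\in G$ such that $\varphi^n(x)=\varphi^m(x)$ for some $n<m$ in $\mathbb N$. A string of $\varphi$ is a sequence $S=\{x_n\}_{n\in\mathbb N}$ of pairwise distinct elements of $G$ with $\varphi(x_n)=x_{n-1}$ for every $n\in\mathbb N_+$. A string is singular if $x_0\in Q\mathrm{Per}(\varphi)$, and non-singular otherwise. The non-singular string number is $ns(\varphi)=\sup\{|\mathcal F|:\mathcal F$ is a family of pairwise disjoint non-singular strings of $\varphi$ in $G\}$ (disjointness refers to the underlying sets of elements); it takes values in $\mathbb N\cup\{\infty\}$, i.e. it is set equal to $\infty$ whenever the supremum is infinite. *)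

theory Defs
  imports "HOL-Algebra.Group" "HOL-Library.Extended_Nat" "HOL-Library.Disjoint_Sets"
begin

definition QPer :: "('a, 'b) monoid_scheme \<Rightarrow> ('a \<Rightarrow> 'a) \<Rightarrow> 'a set" where
  "QPer G \<phi> = {x \<in> carrier G. \<exists>n m :: nat. n < m \<and> (\<phi> ^^ n) x = (\<phi> ^^ m) x}"

definition is_string :: "('a, 'b) monoid_scheme \<Rightarrow> ('a \<Rightarrow> 'a) \<Rightarrow> (nat \<Rightarrow> 'a) \<Rightarrow> bool" where
  "is_string G \<phi> S \<longleftrightarrow> range S \<subseteq> carrier G \<and> inj S \<and> (\<forall>n>0. \<phi> (S n) = S (n - 1))"

definition singular_string :: "('a, 'b) monoid_scheme \<Rightarrow> ('a \<Rightarrow> 'a) \<Rightarrow> (nat \<Rightarrow> 'a) \<Rightarrow> bool" where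
  "singular_string G \<phi> S \<longleftrightarrow> is_string G \<phi> S \<and> S 0 \<in> QPer G \<phi>"

definition nonsingular_string :: "('a, 'b) monoid_scheme \<Rightarrow> ('a \<Rightarrow> 'a) \<Rightarrow> (nat \<Rightarrow> 'a) \<Rightarrow> bool" where
  "nonsingular_string G \<phi> S \<longleftrightarrow> is_string G \<phi> S \<and> \<not> singular_string G \<phi> S"

(* card maps infinite sets to 0, so all infinite cardinals are sent to \<infinity> here. *)
definition ecard :: "'a set \<Rightarrow> enat" where
  "ecard A = (if finite A then enat (card A) else \<infinity>)"

(* The empty family is always admissible, so the supremum is over a nonempty set. *)
definition ns :: "('a, 'b) monoid_scheme \<Rightarrow> ('a \<Rightarrow> 'a) \<Rightarrow> enat" where
  "ns G \<phi> = (SUP F \<in> {F. (\<forall>S\<in>F. nonsingular_string G \<phi> S) \<and> disjoint_family_on range F}. ecard F)"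

end

theory Submission
  imports Defs "HOL-Algebra.Generated_Groups" "HOL-Computational_Algebra.Primes"
begin

text \<open>
  Groups are written additively in the comments. Two strings that share an element have
  starting points \<open>x\<close>, \<open>y\<close> with \<open>\<phi>\<^sup>a x = \<phi>\<^sup>b y\<close> for some \<open>a\<close>, \<open>b\<close>.
  Call such points confluent; confluence is an equivalence relation. Surjectivity lets every point outside \<open>QPer\<close> be continued
  backwards to a non-singular string, so the theorem comes down to this: as soon as some
  point is not quasi-periodic, there are infinitely many pairwise non-confluent points
  outside \<open>QPer\<close>. They are found in one of two ways.

  If some torsion element \<open>x\<close> is not quasi-periodic, take the elements \<open>x + \<phi>\<^sup>j x\<close> with
  \<open>j \<ge> 1\<close>. A confluence between two of them, or quasi-periodicity of one, expresses some
  \<open>\<phi>\<^sup>N x\<close> as an integer combination of the \<open>\<phi>\<^sup>i x\<close> with \<open>i < N\<close>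
  (\<open>monic_torsion_relation_QPer\<close>). These generate a finite subgroup, which is then
  mapped into itself, so \<open>x\<close> would have a finite orbit after all.

  If all torsion elements are quasi-periodic, then an \<open>x\<close> outside \<open>QPer\<close> has all its
  multiples outside \<open>QPer\<close> (\<open>QPer_of_pow_QPer\<close>). This is less obvious than it looks, since
  the endomorphism induced on the quotient by \<open>QPer\<close> may well have non-zero periodic points,
  as the shear \<open>(a, b) \<mapsto> (a + b, b)\<close> of \<open>\<int>\<^sup>2\<close> shows. Now take the multiples \<open>p x\<close> with
  \<open>p\<close> prime. A confluence of \<open>p x\<close> and \<open>q x\<close> says \<open>p \<phi>\<^sup>a x = q \<phi>\<^sup>b x\<close>, so up to torsion \<open>\<phi>\<close>
  acts on \<open>x\<close> like multiplication by the \<open>(a - b)\<close>-th root of \<open>q/p\<close>. This root determines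
  the set \<open>{p, q}\<close>, so no three of the points \<open>p x\<close> are confluent
  (\<open>confluent_prime_powers_unique\<close>).
\<close>

section \<open>Confluent points and disjoint strings\<close>

definition confluent :: "('a \<Rightarrow> 'a) \<Rightarrow> 'a \<Rightarrow> 'a \<Rightarrow> bool" where
  "confluent f x y \<longleftrightarrow> (\<exists>a b. (f ^^ a) x = (f ^^ b) y)"

lemma confluent_sym: "confluent f x y \<Longrightarrow> confluent f y x"
  unfolding confluent_def by metis

lemma confluent_trans:
  assumes "confluent f x y" "confluent f y z"
  shows "confluent f x z"
proof -
  obtain a b c d where ab: "(f ^^ a) x = (f ^^ b) y" and cd: "(f ^^ c) y = (f ^^ d) z"
    using assms unfolding confluent_def by blast
  have "(f ^^ (c + a)) x = (f ^^ (c + b)) y"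
    by (simp add: funpow_add ab)
  also have "\<dots> = (f ^^ (b + d)) z"
    by (simp add: funpow_add add.commute[of c b] cd)
  finally show ?thesis
    unfolding confluent_def by blast
qed

lemma funpow_fixpoint_mult: "(f ^^ k) z = z \<Longrightarrow> (f ^^ (j * k)) z = z"
  by (induction j) (simp_all add: funpow_add)

lemma QPer_iff_eventually_periodic:
  "x \<in> QPer G f \<longleftrightarrow> x \<in> carrier G \<and> (\<exists>a k. 0 < k \<and> (f ^^ (a + k)) x = (f ^^ a) x)"
proof -
  have "(\<exists>n m. n < m \<and> (f ^^ n) x = (f ^^ m) x) \<longleftrightarrow>
        (\<exists>a k. 0 < k \<and> (f ^^ (a + k)) x = (f ^^ a) x)"
    by (metis less_add_same_cancel1 less_imp_add_positive)
  then show ?thesis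
    unfolding QPer_def by blast
qed

lemma QPerI:
  assumes "x \<in> carrier G" "(f ^^ a) x = (f ^^ b) x" "a \<noteq> b"
  shows "x \<in> QPer G f"
  using assms unfolding QPer_def by (metis (mono_tags, lifting) mem_Collect_eq nat_neq_iff)

lemma string_funpow:
  assumes "is_string G f S"
  shows "(f ^^ n) (S (n + m)) = S m"
proof (induction n)
  case (Suc n)
  have "f (S (Suc (n + m))) = S (n + m)"
    using assms unfolding is_string_def by fastforce
  then show ?case
    using Suc by (simp only: funpow_Suc_right o_apply add_Suc)
qed simp

lemma confluent_if_strings_meet:
  assumes "is_string G f S" "is_string G f T" "range S \<inter> range T \<noteq> {}"
  shows "confluent f (S 0) (T 0)"
proof -
  obtain i j where ij: "S i = T j"
    using assms(3) by auto
  have "(f ^^ j) (S 0) = (f ^^ j) ((f ^^ i) (S i))"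
    using string_funpow[OF assms(1), of i 0] by simp
  also have "\<dots> = (f ^^ i) ((f ^^ j) (T j))"
    unfolding ij by (metis add.commute comp_apply funpow_add)
  also have "\<dots> = (f ^^ i) (T 0)"
    using string_funpow[OF assms(2), of j 0] by simp
  finally show ?thesis
    unfolding confluent_def by blast
qed

text \<open>Choosing preimages repeatedly never runs into a repetition, because a repetition
  would make the starting point periodic.\<close>

lemma nonsingular_string_exists:
  assumes surj: "f ` carrier G = carrier G" and x: "x \<in> carrier G" "x \<notin> QPer G f"
  obtains S where "nonsingular_string G f S" "S 0 = x"
proof -
  define S where "S = rec_nat x (\<lambda>_. inv_into (carrier G) f)"
  have S0: "S 0 = x"
    by (simp add: S_def)
  have SSuc: "S (Suc n) = inv_into (carrier G) f (S n)" for n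
    by (simp add: S_def)
  have carr: "S n \<in> carrier G" for n
    using surj x(1) by (induction n) (auto simp: S0 SSuc intro: inv_into_into)
  have step: "f (S (Suc n)) = S n" for n
    unfolding SSuc using surj carr by (intro f_inv_into_f) auto
  have descend: "(f ^^ n) (S (n + m)) = S m" for n m
    by (induction n) (simp_all only: funpow_Suc_right o_apply add_Suc step, simp)
  have neq: "S i \<noteq> S j" if "i < j" for i j
  proof
    assume eq: "S i = S j"
    define d where "d = j - i"
    have "x = S d"
      using descend[of i 0] descend[of i d] that eq by (simp add: S0 d_def)
    then have "(f ^^ d) x = (f ^^ 0) x"
      using descend[of d 0] by (simp add: S0)
    moreover have "d \<noteq> 0"
      using that by (simp add: d_def)
    ultimately show False
      using QPerI x by metis
  qed
  have "inj S"
    by (rule injI) (metis neq nat_neq_iff)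
  moreover have "f (S n) = S (n - 1)" if "n > 0" for n
    using step[of "n - 1"] that by simp
  ultimately have "nonsingular_string G f S"
    using carr x(2) S0
    unfolding nonsingular_string_def singular_string_def is_string_def by auto
  then show ?thesis
    using that S0 by blast
qed

text \<open>Picking one index from each confluence class gives the disjoint strings. The
  classes are only required to be finite because a few coincidences among the points
  do occur in the application to prime multiples.\<close>

lemma ns_infinite_if_finite_confluence_classes:
  assumes surj: "f ` carrier G = carrier G"
    and I: "infinite I"
    and y: "\<And>i. i \<in> I \<Longrightarrow> y i \<in> carrier G" "\<And>i. i \<in> I \<Longrightarrow> y i \<notin> QPer G f"
    and fin: "\<And>i. i \<in> I \<Longrightarrow> finite {j \<in> I. confluent f (y i) (y j)}"
  shows "ns G f = \<infinity>"
proof -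
  define c where "c i = Collect (confluent f (y i))" for i
  have c_eq_iff: "c i = c j \<longleftrightarrow> confluent f (y i) (y j)" for i j
  proof
    assume "c i = c j"
    moreover have "y j \<in> c j"
      unfolding c_def confluent_def by auto
    ultimately show "confluent f (y i) (y j)"
      unfolding c_def by blast
  next
    assume "confluent f (y i) (y j)"
    then have "confluent f (y i) z \<longleftrightarrow> confluent f (y j) z" for z
      by (metis confluent_sym confluent_trans)
    then show "c i = c j"
      unfolding c_def by auto
  qed
  have inf_c: "infinite (c ` I)"
  proof
    assume "finite (c ` I)"
    then obtain i where "i \<in> I" "infinite (c -` {c i} \<inter> I)"
      using inf_img_fin_dom'[OF _ I, of c] by auto
    moreover have "c -` {c i} \<inter> I = {j \<in> I. confluent f (y i) (y j)}"
      unfolding c_eq_iff[symmetric] by auto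
    ultimately show False
      using fin by metis
  qed
  obtain U where U: "U \<subseteq> I" "inj_on c U" "c ` I = c ` U"
    using subset_image_inj[of "c ` I" c I] by auto
  have inf_U: "infinite U"
    using inf_c U(3) by auto
  have "\<exists>S. nonsingular_string G f S \<and> S 0 = y i" if "i \<in> U" for i
    using nonsingular_string_exists[OF surj] y U(1) that by (metis subsetD)
  then obtain S where S: "\<And>i. i \<in> U \<Longrightarrow> nonsingular_string G f (S i)"
      "\<And>i. i \<in> U \<Longrightarrow> S i 0 = y i"
    by metis
  have disj: "range (S i) \<inter> range (S j) = {}" if "i \<in> U" "j \<in> U" "i \<noteq> j" for i j
  proof (rule ccontr)
    assume "range (S i) \<inter> range (S j) \<noteq> {}"
    then have "confluent f (S i 0) (S j 0)"
      using confluent_if_strings_meet S(1) that(1,2) unfolding nonsingular_string_def by metis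
    then have "c i = c j"
      using S(2) that c_eq_iff by metis
    then show False
      using U(2) that by (auto dest: inj_onD)
  qed
  have "inj_on S U"
    by (rule inj_onI) (use disj in fastforce)
  then have "infinite (S ` U)"
    using inf_U finite_imageD by blast
  then have "ecard (S ` U) = \<infinity>"
    by (simp add: ecard_def)
  moreover have "disjoint_family_on range (S ` U)"
    unfolding disjoint_family_on_def using disj by blast
  ultimately have "\<infinity> \<le> ns G f"
    unfolding ns_def using S(1) by (intro SUP_upper2[of "S ` U"]) auto
  then show ?thesis
    by simp
qed

lemma ns_eq_0_if_all_QPer:
  assumes "carrier G = QPer G f"
  shows "ns G f = 0"
proof -
  have "\<not> nonsingular_string G f S" for S
    using assms unfolding nonsingular_string_def singular_string_def is_string_def by blast
  then have "{F. (\<forall>S\<in>F. nonsingular_string G f S) \<and> disjoint_family_on range F} = {{}}"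
    by (auto simp: disjoint_family_on_def)
  then show ?thesis
    by (simp add: ns_def ecard_def zero_enat_def)
qed

section \<open>Endomorphisms of abelian groups\<close>

lemma (in comm_group) finite_generate_torsion:
  assumes "finite S" "S \<subseteq> carrier G" "(n::nat) > 0" "\<And>s. s \<in> S \<Longrightarrow> s [^] n = \<one>"
  shows "finite (generate G S)"
  using assms(1,2,4)
proof (induction S rule: finite_induct)
  case empty
  then show ?case
    by (simp add: generate_empty)
next
  case (insert s S)
  let ?H = "generate G S" and ?K = "generate G {s}"
  have s: "s \<in> carrier G" "s [^] n = \<one>" and S: "S \<subseteq> carrier G"
    using insert.prems by auto
  have pow_mod: "s [^] (k::int) = s [^] (k mod int n)" for k
  proof -
    have "s [^] k = s [^] (int n * (k div int n) + k mod int n)"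
      by simp
    also have "\<dots> = (s [^] int n) [^] (k div int n) \<otimes> s [^] (k mod int n)"
      using s by (simp only: int_pow_mult int_pow_pow)
    finally show ?thesis
      using s by (simp add: int_pow_int)
  qed
  have "?K \<subseteq> (\<lambda>k::int. s [^] k) ` {0..<int n}"
  proof
    fix h assume "h \<in> ?K"
    then obtain k :: int where "h = s [^] k"
      using generate_pow[OF s(1)] by blast
    then have "h = s [^] (k mod int n)" "k mod int n \<in> {0..<int n}"
      using pow_mod assms(3) by auto
    then show "h \<in> (\<lambda>k::int. s [^] k) ` {0..<int n}"
      by blast
  qed
  then have "finite ?K"
    by (rule finite_subset) simp
  moreover have "finite ?H"
    using insert by auto
  ultimately have "finite (?H <#> ?K)"
    unfolding set_mult_def by auto
  moreover have "generate G (insert s S) \<subseteq> ?H <#> ?K"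
  proof (rule generate_subgroup_incl)
    show "subgroup (?H <#> ?K) G"
      using s S by (intro mult_subgroups generate_is_subgroup) auto
    have "h \<in> ?H <#> ?K" if "h \<in> S" for h
    proof -
      have "h = h \<otimes> \<one>"
        using S that by auto
      then show ?thesis
        using that generate.incl[of h S] generate.one[of G "{s}"] unfolding set_mult_def by blast
    qed
    moreover have "s \<in> ?H <#> ?K"
    proof -
      have "s = \<one> \<otimes> s"
        using s by simp
      then show ?thesis
        using generate.incl[of s "{s}"] generate.one[of G S] unfolding set_mult_def by blast
    qed
    ultimately show "insert s S \<subseteq> ?H <#> ?K"
      by blast
  qed
  ultimately show ?case
    by (rule rev_finite_subset)
qed

locale comm_group_endo = comm_group G for G (structure) +
  fixes \<phi> :: "'a \<Rightarrow> 'a"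
  assumes endo: "\<phi> \<in> hom G G"
begin

lemma group_hom_iter: "group_hom G G (\<phi> ^^ n)"
proof -
  have "\<phi> ^^ n \<in> hom G G"
  proof (induction n)
    case 0
    then show ?case by (simp add: hom_def)
  next
    case (Suc n)
    then show ?case using endo by (auto simp: hom_def Pi_iff)
  qed
  then show ?thesis
    by (simp add: group_hom_def group_hom_axioms_def)
qed

lemma iter_closed [simp, intro]: "x \<in> carrier G \<Longrightarrow> (\<phi> ^^ n) x \<in> carrier G"
  using group_hom.hom_closed[OF group_hom_iter] .

lemma iter_mult:
  "x \<in> carrier G \<Longrightarrow> y \<in> carrier G \<Longrightarrow> (\<phi> ^^ n) (x \<otimes> y) = (\<phi> ^^ n) x \<otimes> (\<phi> ^^ n) y"
  using group_hom.hom_mult[OF group_hom_iter] .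

lemma iter_one [simp]: "(\<phi> ^^ n) \<one> = \<one>"
  using group_hom.hom_one[OF group_hom_iter] .

lemma iter_inv: "x \<in> carrier G \<Longrightarrow> (\<phi> ^^ n) (inv x) = inv ((\<phi> ^^ n) x)"
  using group_hom.hom_inv[OF group_hom_iter] .

lemma iter_pow: "x \<in> carrier G \<Longrightarrow> (\<phi> ^^ n) (x [^] (k::nat)) = (\<phi> ^^ n) x [^] k"
  by (induction k) (simp_all add: iter_mult)

lemma iter_iter: "(\<phi> ^^ m) ((\<phi> ^^ n) x) = (\<phi> ^^ (m + n)) x"
  by (simp add: funpow_add)

lemma QPer_if_iter_eq_one:
  assumes "x \<in> carrier G" "(\<phi> ^^ n) x = \<one>"
  shows "x \<in> QPer G \<phi>"
proof (rule QPerI[OF assms(1)])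
  show "(\<phi> ^^ (1 + n)) x = (\<phi> ^^ n) x"
    unfolding iter_iter[symmetric] assms(2) by (rule iter_one)
qed simp

section \<open>Torsion elements that are not quasi-periodic\<close>

text \<open>In the torsion case the \<open>\<phi>\<^sup>i x\<close> with \<open>i < N\<close> generate a finite subgroup, and the
  hypothesis makes it stable under \<open>\<phi>\<close>.\<close>

lemma monic_torsion_relation_QPer:
  assumes x: "x \<in> carrier G" and n: "x [^] (n::nat) = \<one>" "n > 0"
    and rel: "(\<phi> ^^ N) x \<in> generate G ((\<lambda>i. (\<phi> ^^ i) x) ` {..<N})"
  shows "x \<in> QPer G \<phi>"
proof (cases "N = 0")
  case True
  then have "x = \<one>"
    using rel by (simp add: generate_empty)
  then show ?thesis
    using QPer_if_iter_eq_one[of x 0] by simp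
next
  case False
  define T where "T = (\<lambda>i. (\<phi> ^^ i) x) ` {..<N}"
  have T: "T \<subseteq> carrier G" "finite T"
    using x by (auto simp: T_def)
  have "finite (generate G T)"
    using x n T by (intro finite_generate_torsion[of T n]) (auto simp: T_def iter_pow[symmetric])
  moreover have orbit: "(\<phi> ^^ k) x \<in> generate G T" for k
  proof (induction k)
    case 0
    then show ?case
      using False by (intro generate.incl) (force simp: T_def)
  next
    case (Suc k)
    have "\<phi> ` T \<subseteq> generate G T"
    proof
      fix u assume "u \<in> \<phi> ` T"
      then obtain i where i: "i < N" "u = (\<phi> ^^ Suc i) x"
        by (auto simp: T_def)
      show "u \<in> generate G T"
      proof (cases "Suc i = N")
        case True
        then show ?thesis using rel i by (simp add: T_def)
      next
        case False
        then show ?thesis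
          using i by (intro generate.incl) (auto simp: T_def image_iff intro!: bexI[of _ "Suc i"])
      qed
    qed
    then have "generate G (\<phi> ` T) \<subseteq> generate G T"
      using T(1) by (intro generate_subgroup_incl generate_is_subgroup)
    then have "\<phi> ` generate G T \<subseteq> generate G T"
      using group_hom.generate_img[OF group_hom_iter[of 1] T(1)] by simp
    then show ?case
      using Suc by auto
  qed
  ultimately have "finite (range (\<lambda>k. (\<phi> ^^ k) x))"
    by (meson finite_subset image_subsetI)
  then have "\<not> inj (\<lambda>k. (\<phi> ^^ k) x)"
    using finite_imageD infinite_UNIV_nat by blast
  then obtain a b where "(\<phi> ^^ a) x = (\<phi> ^^ b) x" "a \<noteq> b"
    unfolding inj_def by blast
  then show ?thesis
    using QPerI x by metis
qed

text \<open>The relation has four terms, with coefficients \<open>\<plusminus>1\<close>, so it can be solved for the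
  one of highest exponent.\<close>

lemma torsion_four_term_QPer:
  assumes x: "x \<in> carrier G" and n: "x [^] (n::nat) = \<one>" "n > 0"
    and eq: "(\<phi> ^^ a) x \<otimes> (\<phi> ^^ b) x = (\<phi> ^^ c) x \<otimes> (\<phi> ^^ N) x"
    and less: "a < N" "b < N" "c < N"
  shows "x \<in> QPer G \<phi>"
proof (rule monic_torsion_relation_QPer[OF x n])
  let ?T = "(\<lambda>i. (\<phi> ^^ i) x) ` {..<N}"
  have T: "?T \<subseteq> carrier G"
    using x by auto
  have mem: "(\<phi> ^^ i) x \<in> generate G ?T" if "i < N" for i
    using that by (intro generate.incl) auto
  have "(\<phi> ^^ N) x = inv ((\<phi> ^^ c) x) \<otimes> ((\<phi> ^^ a) x \<otimes> (\<phi> ^^ b) x)"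
    using eq x by (simp add: inv_solve_left)
  moreover have "inv ((\<phi> ^^ c) x) \<otimes> ((\<phi> ^^ a) x \<otimes> (\<phi> ^^ b) x) \<in> generate G ?T"
    using mem less generate_m_inv_closed[OF T] by (intro generate.eng) auto
  ultimately show "(\<phi> ^^ N) x \<in> generate G ?T"
    by simp
qed

lemma torsion_shift_sums:
  assumes x: "x \<in> carrier G" "x \<notin> QPer G \<phi>" and n: "x [^] (n::nat) = \<one>" "n > 0"
    and ij: "i > 0" "j > 0"
    and eq: "(\<phi> ^^ a) (x \<otimes> (\<phi> ^^ i) x) = (\<phi> ^^ b) (x \<otimes> (\<phi> ^^ j) x)"
  shows "a = b \<and> i = j"
proof -
  have eq': "(\<phi> ^^ a) x \<otimes> (\<phi> ^^ (a + i)) x = (\<phi> ^^ b) x \<otimes> (\<phi> ^^ (b + j)) x"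
    using eq x(1) by (simp add: iter_mult iter_iter)
  consider "a + i < b + j" | "b + j < a + i" | "a + i = b + j"
    by linarith
  then show ?thesis
  proof cases
    case 1
    then show ?thesis
      using torsion_four_term_QPer[OF x(1) n eq'] ij x(2) by simp
  next
    case 2
    then show ?thesis
      using torsion_four_term_QPer[OF x(1) n eq'[symmetric]] ij x(2) by simp
  next
    case 3
    then have "(\<phi> ^^ a) x = (\<phi> ^^ b) x"
      using eq' x(1) by simp
    then have "a = b"
      using QPerI x by metis
    then show ?thesis
      using 3 by simp
  qed
qed

lemma ns_infinite_if_torsion:
  assumes surj: "\<phi> ` carrier G = carrier G"
    and x: "x \<in> carrier G" "x \<notin> QPer G \<phi>" and n: "x [^] (n::nat) = \<one>" "n > 0"
  shows "ns G \<phi> = \<infinity>"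
proof (rule ns_infinite_if_finite_confluence_classes[OF surj,
    where I = "{0<..}" and y = "\<lambda>j. x \<otimes> (\<phi> ^^ j) x"])
  let ?y = "\<lambda>j. x \<otimes> (\<phi> ^^ j) x"
  show "infinite {0::nat<..}"
    by (rule infinite_Ioi)
  show "?y i \<in> carrier G" for i
    using x by simp
  show "?y i \<notin> QPer G \<phi>" if "i \<in> {0<..}" for i
  proof
    assume "?y i \<in> QPer G \<phi>"
    then obtain a b where "a < b" "(\<phi> ^^ a) (?y i) = (\<phi> ^^ b) (?y i)"
      unfolding QPer_def by blast
    then show False
      using torsion_shift_sums[OF x n, of i i a b] that by auto
  qed
  show "finite {j \<in> {0<..}. confluent \<phi> (?y i) (?y j)}" if "i \<in> {0<..}" for i
  proof (rule finite_subset)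
    show "{j \<in> {0<..}. confluent \<phi> (?y i) (?y j)} \<subseteq> {i}"
    proof
      fix j assume "j \<in> {j \<in> {0<..}. confluent \<phi> (?y i) (?y j)}"
      then obtain a b where "j > 0" "(\<phi> ^^ a) (?y i) = (\<phi> ^^ b) (?y j)"
        unfolding confluent_def by blast
      then show "j \<in> {i}"
        using torsion_shift_sums[OF x n, of i j a b] that by auto
    qed
  qed simp
qed

section \<open>Elements with no quasi-periodic multiple\<close>

text \<open>After iterating, \<open>y\<close> has a multiple \<open>n y\<close> fixed by some \<open>\<psi> = \<phi>\<^sup>k\<close>. The difference
  \<open>\<psi> y - y\<close> is then torsion, hence fixed by some \<open>\<phi>\<^sup>l\<close> after more iteration. Under
  \<open>\<chi> = \<psi>\<^sup>l\<close> the point \<open>y\<close> moves by a \<open>\<chi>\<close>-fixed torsion element in each step, so it is back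
  after \<open>n\<close> steps.\<close>

lemma QPer_of_pow_QPer:
  assumes tors: "\<And>w. w \<in> carrier G \<Longrightarrow> w [^] n = \<one> \<Longrightarrow> w \<in> QPer G \<phi>"
    and n: "(n::nat) > 0" and x: "x \<in> carrier G" "x [^] n \<in> QPer G \<phi>"
  shows "x \<in> QPer G \<phi>"
proof -
  obtain a k where k: "k > 0" and ak: "(\<phi> ^^ (a + k)) (x [^] n) = (\<phi> ^^ a) (x [^] n)"
    using x(2) unfolding QPer_iff_eventually_periodic by blast
  define v0 where "v0 = (\<phi> ^^ (a + k)) x \<otimes> inv ((\<phi> ^^ a) x)"
  have v0: "v0 \<in> carrier G"
    using x by (simp add: v0_def)
  have "v0 [^] n = (\<phi> ^^ (a + k)) (x [^] n) \<otimes> inv ((\<phi> ^^ a) (x [^] n))"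
    using x by (simp add: v0_def pow_mult_distrib m_comm nat_pow_inv iter_pow)
  then have "v0 [^] n = \<one>"
    using x ak by simp
  then have "v0 \<in> QPer G \<phi>"
    using tors v0 by blast
  then obtain b l where l: "l > 0" and bl: "(\<phi> ^^ (b + l)) v0 = (\<phi> ^^ b) v0"
    unfolding QPer_iff_eventually_periodic by blast
  define y where "y = (\<phi> ^^ (a + b)) x"
  define D where "D j = (\<phi> ^^ (j * k)) y \<otimes> inv y" for j
  have y: "y \<in> carrier G"
    using x by (simp add: y_def)
  have D: "D j \<in> carrier G" for j
    using y by (simp add: D_def)
  have D1: "D 1 = (\<phi> ^^ b) v0"
    using x by (simp add: D_def v0_def y_def iter_mult iter_inv iter_iter add_ac)
  have "(\<phi> ^^ l) (D 1) = D 1"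
    using bl unfolding D1 by (simp add: iter_iter add.commute)
  then have D1_fix: "(\<phi> ^^ (l * k)) (D 1) = D 1"
    using funpow_fixpoint_mult[of l \<phi> "D 1" k] by (simp add: mult.commute)
  have D_Suc: "D (Suc j) = (\<phi> ^^ k) (D j) \<otimes> D 1" for j
    using y by (simp add: D_def iter_mult iter_inv iter_iter m_assoc inv_solve_left add.commute)
  have D_fix: "(\<phi> ^^ (l * k)) (D j) = D j" for j
  proof (induction j)
    case 0
    then show ?case
      using y by (simp add: D_def)
  next
    case (Suc j)
    have "(\<phi> ^^ (l * k)) ((\<phi> ^^ k) (D j)) = (\<phi> ^^ k) (D j)"
      by (metis Suc iter_iter add.commute)
    then show ?case
      using D by (simp only: D_Suc[of j] iter_mult iter_closed D1_fix)
  qed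
  have "(\<phi> ^^ k) (y [^] n) = (\<phi> ^^ b) ((\<phi> ^^ (a + k)) (x [^] n))"
    using x by (simp add: y_def iter_pow iter_iter add_ac)
  also have "\<dots> = y [^] n"
    unfolding ak using x by (simp add: y_def iter_pow iter_iter add_ac)
  finally have "(\<phi> ^^ (l * k)) (y [^] n) = y [^] n"
    by (rule funpow_fixpoint_mult)
  then have D_pow: "D l [^] n = \<one>"
    using y by (simp add: D_def pow_mult_distrib m_comm nat_pow_inv iter_pow)
  have translate: "(\<phi> ^^ (i * (l * k))) y = y \<otimes> D l [^] i" for i
  proof (induction i)
    case 0
    then show ?case
      using y by simp
  next
    case (Suc i)
    have "(\<phi> ^^ (Suc i * (l * k))) y = (\<phi> ^^ (l * k)) (y \<otimes> D l [^] i)"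
      using Suc by (simp add: funpow_add)
    also have "\<dots> = (\<phi> ^^ (l * k)) y \<otimes> D l [^] i"
      using y D D_fix by (simp add: iter_mult iter_pow)
    also have "(\<phi> ^^ (l * k)) y = y \<otimes> D l"
      using y by (simp add: D_def m_comm[of _ "inv y"] m_assoc[symmetric])
    finally show ?case
      using y D by (simp add: m_ac)
  qed
  have "(\<phi> ^^ (n * (l * k) + (a + b))) x = (\<phi> ^^ (a + b)) x"
    using translate[of n] D_pow y by (simp add: y_def iter_iter)
  then show ?thesis
    by (rule QPerI[OF x(1)]) (use n k l in simp)
qed

lemma iter_pow_inject:
  assumes x: "x \<in> carrier G" "\<And>n::nat. n > 0 \<Longrightarrow> x [^] n \<notin> QPer G \<phi>"
    and eq: "(\<phi> ^^ N) x [^] (m::nat) = (\<phi> ^^ N) x [^] n"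
  shows "m = n"
  using eq
proof (induction m n rule: linorder_wlog)
  case (le m n)
  let ?z = "(\<phi> ^^ N) x"
  have "?z [^] (n - m) = \<one>"
    using pow_eq_div2[of ?z n m] le x(1) by simp
  then have "(\<phi> ^^ N) (x [^] (n - m)) = \<one>"
    using x(1) by (simp add: iter_pow)
  then have "x [^] (n - m) \<in> QPer G \<phi>"
    using x(1) by (intro QPer_if_iter_eq_one) auto
  then show ?case
    using x(2)[of "n - m"] le by fastforce
qed metis

text \<open>The relations \<open>m \<phi>\<^sup>i x = n \<phi>\<^sup>j x\<close> multiply like the pairs
  \<open>(m/n, i - j)\<close> in \<open>\<rat>\<^sup>* \<times> \<int>\<close>.\<close>

lemma pow_relation_mult:
  assumes x: "x \<in> carrier G"
    and "(\<phi> ^^ i) x [^] (m::nat) = (\<phi> ^^ j) x [^] (n::nat)"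
    and "(\<phi> ^^ i') x [^] (m'::nat) = (\<phi> ^^ j') x [^] (n'::nat)"
  shows "(\<phi> ^^ (i + i')) x [^] (m * m') = (\<phi> ^^ (j + j')) x [^] (n * n')"
proof -
  have swap: "(\<phi> ^^ s) ((\<phi> ^^ t) x [^] (p::nat)) [^] (q::nat) = (\<phi> ^^ (s + t)) x [^] (p * q)"
    for s t p q
    using x by (simp add: iter_pow iter_iter nat_pow_pow)
  have "(\<phi> ^^ (i + i')) x [^] (m * m') = (\<phi> ^^ i') ((\<phi> ^^ i) x [^] m) [^] m'"
    by (simp add: swap add.commute)
  also have "\<dots> = (\<phi> ^^ j) ((\<phi> ^^ i') x [^] m') [^] n"
    unfolding assms(2) by (simp add: swap add.commute mult.commute)
  also have "\<dots> = (\<phi> ^^ (j + j')) x [^] (n * n')"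
    unfolding assms(3) by (simp add: swap mult.commute)
  finally show ?thesis .
qed

lemma pow_relation_power:
  assumes x: "x \<in> carrier G"
    and "(\<phi> ^^ i) x [^] (m::nat) = (\<phi> ^^ j) x [^] (n::nat)"
  shows "(\<phi> ^^ (t * i)) x [^] (m ^ t) = (\<phi> ^^ (t * j)) x [^] (n ^ t)"
proof (induction t)
  case (Suc t)
  then show ?case
    using pow_relation_mult[OF x assms(2) Suc] by simp
qed simp

text \<open>Raising the two confluences to suitable powers and multiplying them, the second one
  possibly reversed, equalises the iterates on both sides. What is left is an equation
  between products of prime powers, in which one of the primes \<open>q\<close>, \<open>r\<close> divides just one
  side.\<close>

lemma confluent_prime_powers_unique:
  assumes x: "x \<in> carrier G" "\<And>n::nat. n > 0 \<Longrightarrow> x [^] n \<notin> QPer G \<phi>"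
    and pqr: "prime (p::nat)" "prime (q::nat)" "prime (r::nat)" and ne: "q \<noteq> p" "r \<noteq> p"
    and cq: "confluent \<phi> (x [^] p) (x [^] q)" and cr: "confluent \<phi> (x [^] p) (x [^] r)"
  shows "q = r"
proof (rule ccontr)
  assume qr: "q \<noteq> r"
  obtain a b where ab: "(\<phi> ^^ a) x [^] p = (\<phi> ^^ b) x [^] q"
    using cq x(1) unfolding confluent_def by (auto simp: iter_pow)
  obtain c d where cd: "(\<phi> ^^ c) x [^] p = (\<phi> ^^ d) x [^] r"
    using cr x(1) unfolding confluent_def by (auto simp: iter_pow)
  have "a \<noteq> b" "c \<noteq> d"
    using iter_pow_inject[OF x] ab cd ne by metis+
  define s where "s = nat \<bar>int a - int b\<bar>"
  define t where "t = nat \<bar>int c - int d\<bar>"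
  have st: "s > 0" "t > 0"
    using \<open>a \<noteq> b\<close> \<open>c \<noteq> d\<close> by (auto simp: s_def t_def)
  have ab': "(\<phi> ^^ (t * a)) x [^] (p ^ t) = (\<phi> ^^ (t * b)) x [^] (q ^ t)"
    by (rule pow_relation_power[OF x(1) ab])
  have cd': "(\<phi> ^^ (s * c)) x [^] (p ^ s) = (\<phi> ^^ (s * d)) x [^] (r ^ s)"
    by (rule pow_relation_power[OF x(1) cd])
  show False
  proof (cases "(a < b) = (c < d)")
    case True
    have "int (t * a + s * d) = int (t * b + s * c)"
      using True by (auto simp: s_def t_def algebra_simps abs_if)
    then have "t * a + s * d = t * b + s * c"
      by (simp only: of_nat_eq_iff)
    then have eq: "p ^ t * r ^ s = q ^ t * p ^ s"
      using pow_relation_mult[OF x(1) ab' cd'[symmetric]] iter_pow_inject[OF x] by metis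
    have "r dvd p ^ t * r ^ s"
      using st by simp
    then have "r dvd q \<or> r dvd p"
      unfolding eq using pqr(3) by (metis prime_dvd_multD prime_dvd_power)
    then show False
      using pqr ne qr primes_dvd_imp_eq by metis
  next
    case False
    have "int (t * a + s * c) = int (t * b + s * d)"
      using False \<open>a \<noteq> b\<close> \<open>c \<noteq> d\<close> by (auto simp: s_def t_def algebra_simps abs_if)
    then have "t * a + s * c = t * b + s * d"
      by (simp only: of_nat_eq_iff)
    then have eq: "p ^ t * p ^ s = q ^ t * r ^ s"
      using pow_relation_mult[OF x(1) ab' cd'] iter_pow_inject[OF x] by metis
    have "q dvd q ^ t * r ^ s"
      using st by simp
    then have "q dvd p"
      unfolding eq[symmetric] using pqr(2) by (metis prime_dvd_multD prime_dvd_power)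
    then show False
      using pqr ne primes_dvd_imp_eq by metis
  qed
qed

lemma ns_infinite_if_no_pow_QPer:
  assumes surj: "\<phi> ` carrier G = carrier G"
    and x: "x \<in> carrier G" "\<And>n::nat. n > 0 \<Longrightarrow> x [^] n \<notin> QPer G \<phi>"
  shows "ns G \<phi> = \<infinity>"
proof (rule ns_infinite_if_finite_confluence_classes[OF surj,
    where I = "{p::nat. prime p}" and y = "\<lambda>p. x [^] p"])
  show "infinite {p::nat. prime p}"
    by (rule primes_infinite)
  show "x [^] p \<in> carrier G" for p :: nat
    using x by simp
  show "x [^] p \<notin> QPer G \<phi>" if "p \<in> {p. prime p}" for p :: nat
    using that x(2) prime_gt_0_nat by blast
  show "finite {q \<in> {q::nat. prime q}. confluent \<phi> (x [^] p) (x [^] q)}" (is "finite ?C")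
    if "p \<in> {p. prime p}" for p :: nat
  proof (cases "?C \<subseteq> {p}")
    case False
    then obtain q where q: "q \<in> ?C" "q \<noteq> p"
      by blast
    have "?C \<subseteq> {p, q}"
      using confluent_prime_powers_unique[OF x, of p q] q that by blast
    then show ?thesis
      by (rule finite_subset) simp
  qed (auto intro: finite_subset)
qed

lemma ns_infinite_if_not_all_QPer:
  assumes surj: "\<phi> ` carrier G = carrier G" and ne: "carrier G \<noteq> QPer G \<phi>"
  shows "ns G \<phi> = \<infinity>"
proof (cases "\<exists>w\<in>carrier G. w \<notin> QPer G \<phi> \<and> (\<exists>n::nat. n > 0 \<and> w [^] n = \<one>)")
  case True
  then show ?thesis
    using ns_infinite_if_torsion[OF surj] by blast
next
  case False
  obtain x where x: "x \<in> carrier G" "x \<notin> QPer G \<phi>"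
    using ne unfolding QPer_def by blast
  have "x [^] n \<notin> QPer G \<phi>" if "n > 0" for n :: nat
    using QPer_of_pow_QPer[of n x] False x that by blast
  then show ?thesis
    by (rule ns_infinite_if_no_pow_QPer[OF surj x(1)])
qed

end

section \<open>The three conditions\<close>

theorem mainTheorem5:
  fixes G :: "('a, 'b) monoid_scheme" and \<phi> :: "'a \<Rightarrow> 'a"
  assumes "comm_group G"
    and "\<phi> \<in> hom G G"
    and "\<phi> ` carrier G = carrier G"
  shows "(ns G \<phi> = 0 \<longleftrightarrow> ns G \<phi> < \<infinity>) \<and> (ns G \<phi> < \<infinity> \<longleftrightarrow> carrier G = QPer G \<phi>)"
proof -
  interpret comm_group_endo G \<phi>
    using assms by (simp add: comm_group_endo_def comm_group_endo_axioms_def)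
  have "carrier G = QPer G \<phi> \<Longrightarrow> ns G \<phi> = 0"
    by (rule ns_eq_0_if_all_QPer)
  moreover have "carrier G \<noteq> QPer G \<phi> \<Longrightarrow> ns G \<phi> = \<infinity>"
    by (rule ns_infinite_if_not_all_QPer[OF assms(3)])
  ultimately show ?thesis
    by (cases "carrier G = QPer G \<phi>") auto
qed

end
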